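(* Fix a time $t\ge 0$, and let $\Phi_1,\Phi_2,\varphi$ satisfy the linearized two-layer potential problem with ship shape $f$, ship position $X(t)\in\Omega$ and ship velocity $\boldsymbol U(t)$, where $\Omega=\mathbb{R}^d$, $d\in\{1,2\}$: $$\Delta\Phi_1=0\ (\boldsymbol x\in\Omega,\ 0\le z\le h_1),\qquad \Delta\Phi_2=0\ (\boldsymbol x\in\Omega,\ -h_2\le z\le0),$$ $$\frac{\partial\Phi_2}{\partial z}(t,\boldsymbol x,-h_2)=0,\qquad \frac{\partial\Phi_1}{\partial z}(t,\boldsymbol x,h_1)=-\boldsymbol U(t)\cdot\nabla_{\boldsymbol x}f(\boldsymbol x-X(t)),$$ $$\frac{\partial\Phi_1}{\partial z}(t,\boldsymbol x,0)=\frac{\partial\Phi_2}{\partial z}(t,\boldsymbol x,0),\qquad \varphi(t,\boldsymbol x)=\rho_1\Phi_1(t,\boldsymbol x,0)-\rho_2\Phi_2(t,\boldsymbol x,0).$$ Let $T[\varphi(t,\cdot)]=\frac{\partial\Phi_2}{\partial z}(t,\cdot,0)$. Then for every $\boldsymbol\kappa\in\mathbb{R}^d\setminus\{0\}$, $$\widehat{T[\varphi(t,\cdot)]}_{\boldsymbol\kappa}=-\frac{2\pi|\boldsymbol\kappa|_2}{T_{1,\boldsymbol\kappa}+T_{2,\boldsymbol\kappa}}\hat\varphi_{\boldsymbol\kappa}-\hat g_{\boldsymbol\kappa},$$ where $T_{j,\boldsymbol\kappa}=\rho_j\coth(2\pi|\boldsymbol\kappa|_2h_j)$ for $j\in\{1,2\}$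 and $$\hat g_{\boldsymbol\kappa}=\frac{2\pi\rho_1\,i\,\boldsymbol\kappa\cdot\boldsymbol U(t)\,e^{-2\pi i\boldsymbol\kappa\cdot X(t)}\hat f_{\boldsymbol\kappa}}{\sinh(2\pi|\boldsymbol\kappa|_2h_1)(T_{1,\boldsymbol\kappa}+T_{2,\boldsymbol\kappa})}.$$
   Context: Constants: $0<\rho_1<\rho_2$ (densities), $h_1,h_2>0$ (layer thicknesses). $\boldsymbol x\in\Omega$ is the horizontal variable, $z$ the vertical one; $\Delta=\Delta_{\boldsymbol x}+\partial_z^2$. $|\cdot|_2$ is the Euclidean norm. The horizontal Fourier transform is $\hat\xi_{\boldsymbol\kappa}=\int_\Omega\xi(\boldsymbol x)e^{-2\pi i\boldsymbol\kappa\cdot\boldsymbol x}d\boldsymbol x$. All functions ($f$, and $\Phi_1,\Phi_2$ together with their derivatives up to order two, up to the boundaries $z=-h_2,0,h_1$) are assumed regular enough and sufficiently decaying as $|\boldsymbol x|_2\to\infty$ that their horizontal Fourier transforms exist, that $\widehat{\Delta_{\boldsymbol x}\xi}_{\boldsymbol\kappa}=-4\pi^2|\boldsymbol\kappa|_2^2\hat\xi_{\boldsymbol\kappa}$ and $\widehat{\nabla_{\boldsymbol x}\xi}_{\boldsymbol\kappa}=2\pi i\boldsymbol\kappa\hat\xi_{\boldsymbol\kappa}$ hold for them, and that the transform commutes with $\partial_z$ and $\partial_z^2$. *)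

theory Defs
  imports "HOL-Analysis.Analysis"
begin

definition coth :: "real \<Rightarrow> real" where
  "coth x = cosh x / sinh x"

definition fourier :: "(real ^ 'n \<Rightarrow> real) \<Rightarrow> real ^ 'n \<Rightarrow> complex" where
  "fourier \<xi> \<kappa> =
    (LINT x|lborel. complex_of_real (\<xi> x) * exp (- (2 * pi * \<i> * complex_of_real (\<kappa> \<bullet> x))))"

definition partial_x :: "'n \<Rightarrow> (real ^ 'n \<Rightarrow> real) \<Rightarrow> real ^ 'n \<Rightarrow> real" where
  "partial_x i \<xi> x = frechet_derivative \<xi> (at x) (axis i 1)"

definition grad_x :: "(real ^ 'n \<Rightarrow> real) \<Rightarrow> real ^ 'n \<Rightarrow> real ^ 'n" where
  "grad_x \<xi> x = (\<chi> i. partial_x i \<xi> x)"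

definition laplace_x :: "(real ^ 'n \<Rightarrow> real) \<Rightarrow> real ^ 'n \<Rightarrow> real" where
  "laplace_x \<xi> x = (\<Sum>i\<in>UNIV. partial_x i (partial_x i \<xi>) x)"

text \<open>The vertical derivative is taken relative to the vertical extent \<open>I\<close> of a layer: it is the
  usual derivative in the interior of \<open>I\<close> and the one-sided one at the end points. This keeps apart
  the two layers, which share the level \<open>z = 0\<close>.\<close>

definition partial_z ::
    "real set \<Rightarrow> (real ^ 'n \<Rightarrow> real \<Rightarrow> real) \<Rightarrow> real ^ 'n \<Rightarrow> real \<Rightarrow> real" where
  "partial_z I \<Phi> x z = vector_derivative (\<Phi> x) (at z within I)"

definition laplace ::
    "real set \<Rightarrow> (real ^ 'n \<Rightarrow> real \<Rightarrow> real) \<Rightarrow> real ^ 'n \<Rightarrow> real \<Rightarrow> real" where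
  "laplace I \<Phi> x z = laplace_x (\<lambda>y. \<Phi> y z) x + partial_z I (partial_z I \<Phi>) x z"

definition integrable_with_gradient :: "(real ^ 'n \<Rightarrow> real) \<Rightarrow> bool" where
  "integrable_with_gradient \<xi> \<longleftrightarrow>
    (\<forall>x. \<xi> differentiable (at x)) \<and> integrable lborel \<xi> \<and>
    (\<forall>i. integrable lborel (partial_x i \<xi>))"

text \<open>``Regular enough and sufficiently decaying'' in the horizontal variable: derivatives up to
  order two exist and have Fourier transforms, and the transform turns the gradient
  (componentwise) and the Laplacian into the usual multipliers.\<close>

definition fourier_regular :: "(real ^ 'n \<Rightarrow> real) \<Rightarrow> bool" where
  "fourier_regular \<xi> \<longleftrightarrow>
    integrable_with_gradient \<xi> \<and>
    (\<forall>i. integrable_with_gradient (partial_x i \<xi>)) \<and>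
    (\<forall>\<kappa> i. fourier (partial_x i \<xi>) \<kappa> =
      2 * pi * \<i> * complex_of_real (\<kappa> $ i) * fourier \<xi> \<kappa>) \<and>
    (\<forall>\<kappa>. fourier (laplace_x \<xi>) \<kappa> = - 4 * pi\<^sup>2 * (norm \<kappa>)\<^sup>2 * fourier \<xi> \<kappa>)"

text \<open>The same for a potential in the layer of vertical extent \<open>I\<close>, up to the boundary. The last
  two conjuncts say that the horizontal transform commutes with the first and the second vertical
  derivative, the second derivative of the transform being the derivative of the first one.\<close>

definition layer_regular :: "real set \<Rightarrow> (real ^ 'n \<Rightarrow> real \<Rightarrow> real) \<Rightarrow> bool" where
  "layer_regular I \<Phi> \<longleftrightarrow>
    (\<forall>z\<in>I. fourier_regular (\<lambda>x. \<Phi> x z) \<and>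
      integrable_with_gradient (\<lambda>x. partial_z I \<Phi> x z) \<and>
      integrable lborel (\<lambda>x. partial_z I (partial_z I \<Phi>) x z) \<and>
      (\<forall>x. \<Phi> x differentiable (at z within I) \<and>
        partial_z I \<Phi> x differentiable (at z within I)) \<and>
      (\<forall>\<kappa>. ((\<lambda>s. fourier (\<lambda>x. \<Phi> x s) \<kappa>) has_vector_derivative
        fourier (\<lambda>x. partial_z I \<Phi> x z) \<kappa>) (at z within I)) \<and>
      (\<forall>\<kappa>. ((\<lambda>s. fourier (\<lambda>x. partial_z I \<Phi> x s) \<kappa>) has_vector_derivative
        fourier (\<lambda>x. partial_z I (partial_z I \<Phi>) x z) \<kappa>) (at z within I)))"

definition layer_coeff :: "real \<Rightarrow> real \<Rightarrow> real ^ 'n \<Rightarrow> real" where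
  "layer_coeff \<rho> h \<kappa> = \<rho> * coth (2 * pi * norm \<kappa> * h)"

end

theory Submission
  imports Defs
begin

text \<open>For fixed \<open>\<kappa>\<close> the transform \<open>A\<close> of a harmonic potential satisfies \<open>A'' = m\<^sup>2 A\<close> with
  \<open>m = 2 \<pi> |\<kappa>|\<close>, so \<open>A' z cosh (m (z - c)) - m A z sinh (m (z - c))\<close> does not depend on \<open>z\<close>.
  Comparing its values at the interface and at \<open>c\<close>, the outer wall of the layer, expresses \<open>A 0\<close>
  through \<open>A' 0\<close> and the boundary datum \<open>A' c\<close>. Inserting this for both layers into the transform
  of \<open>\<phi>\<close> gives a linear equation for the common value of \<open>A' 0\<close>.\<close>

lemma integrable_fourier_kernel:
  fixes \<xi> :: "real ^ 'n \<Rightarrow> real"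
  assumes "integrable lborel \<xi>"
  shows "integrable lborel
    (\<lambda>x. complex_of_real (\<xi> x) * exp (- (2 * pi * \<i> * complex_of_real (\<kappa> \<bullet> x))))"
proof (rule Bochner_Integration.integrable_bound[OF assms])
  have [measurable]: "\<xi> \<in> borel_measurable borel"
    using borel_measurable_integrable[OF assms] by simp
  show "(\<lambda>x. complex_of_real (\<xi> x) * exp (- (2 * pi * \<i> * complex_of_real (\<kappa> \<bullet> x))))
      \<in> borel_measurable lborel"
    by (intro borel_measurable_times) (auto intro!: borel_measurable_continuous_onI continuous_intros)
  show "AE x in lborel. norm (complex_of_real (\<xi> x) *
      exp (- (2 * pi * \<i> * complex_of_real (\<kappa> \<bullet> x)))) \<le> norm (\<xi> x)"
    by (simp add: norm_mult)
qed

text \<open>This covers every \<open>\<xi>\<close>: a non-integrable integrand has integral 0 by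
  convention, and so have its multiples.\<close>

lemma fourier_cmult: "fourier (\<lambda>x. c * \<xi> x) \<kappa> = complex_of_real c * fourier \<xi> \<kappa>"
  unfolding fourier_def by (simp add: mult.assoc)

lemma fourier_minus: "fourier (\<lambda>x. - \<xi> x) \<kappa> = - fourier \<xi> \<kappa>"
  using fourier_cmult[of "-1" \<xi> \<kappa>] by simp

lemma fourier_diff:
  assumes "integrable lborel \<xi>" "integrable lborel \<eta>"
  shows "fourier (\<lambda>x. \<xi> x - \<eta> x) \<kappa> = fourier \<xi> \<kappa> - fourier \<eta> \<kappa>"
  unfolding fourier_def of_real_diff left_diff_distrib
  by (rule Bochner_Integration.integral_diff) (rule integrable_fourier_kernel; fact)+

lemma fourier_sum:
  assumes "\<And>i. i \<in> I \<Longrightarrow> integrable lborel (\<xi> i)"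
  shows "fourier (\<lambda>x. \<Sum>i\<in>I. \<xi> i x) \<kappa> = (\<Sum>i\<in>I. fourier (\<xi> i) \<kappa>)"
  unfolding fourier_def of_real_sum sum_distrib_right
  by (rule Bochner_Integration.integral_sum) (rule integrable_fourier_kernel, rule assms)

text \<open>Lebesgue measure is translation invariant, and the character splits off the factor at
  \<open>a\<close>. This produces the phase due to the ship position.\<close>

lemma fourier_translate:
  fixes \<xi> :: "real ^ 'n \<Rightarrow> real"
  assumes "integrable lborel \<xi>"
  shows "fourier (\<lambda>x. \<xi> (x - a)) \<kappa> =
    exp (- (2 * pi * \<i> * complex_of_real (\<kappa> \<bullet> a))) * fourier \<xi> \<kappa>"
proof -
  let ?e = "\<lambda>x. exp (- (2 * pi * \<i> * complex_of_real (\<kappa> \<bullet> x)))"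
  have [measurable]: "\<xi> \<in> borel_measurable borel"
    using borel_measurable_integrable[OF assms] by simp
  have [measurable]: "?e \<in> borel_measurable borel"
    by (intro borel_measurable_continuous_onI continuous_intros)
  \<comment> \<open>Writing \<open>lborel\<close> as its own image under \<open>(+) a\<close> turns
    the substitution into the transformation rule for image measures.\<close>
  have "fourier (\<lambda>x. \<xi> (x - a)) \<kappa> =
      (LINT x|distr lborel borel ((+) a). complex_of_real (\<xi> (x - a)) * ?e x)"
    unfolding fourier_def lborel_distr_plus ..
  also have "\<dots> = (LINT x|lborel. complex_of_real (\<xi> (a + x - a)) * ?e (a + x))"
    by (rule integral_distr) measurable
  also have "\<dots> = (LINT x|lborel. ?e a * (complex_of_real (\<xi> x) * ?e x))"
    by (intro Bochner_Integration.integral_cong refl)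
      (simp add: inner_add_right distrib_left exp_add[symmetric] algebra_simps)
  finally show ?thesis
    unfolding fourier_def by simp
qed

text \<open>Prepares the transform of the ship condition. Integrability is recorded as well because
  \<open>fourier_translate\<close> will be applied to this function.\<close>

lemma fourier_inner_grad:
  fixes \<xi> :: "real ^ 'n \<Rightarrow> real"
  assumes "fourier_regular \<xi>"
  shows "integrable lborel (\<lambda>x. u \<bullet> grad_x \<xi> x)"
    and "fourier (\<lambda>x. u \<bullet> grad_x \<xi> x) \<kappa> = 2 * pi * \<i> * (\<kappa> \<bullet> u) * fourier \<xi> \<kappa>"
proof -
  have grad: "(\<lambda>x. u \<bullet> grad_x \<xi> x) = (\<lambda>x. \<Sum>i\<in>UNIV. u $ i * partial_x i \<xi> x)"
    by (simp add: grad_x_def inner_vec_def)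
  have int: "integrable lborel (\<lambda>x. u $ i * partial_x i \<xi> x)" for i
    using assms by (simp add: fourier_regular_def integrable_with_gradient_def)
  show "integrable lborel (\<lambda>x. u \<bullet> grad_x \<xi> x)"
    unfolding grad by (intro Bochner_Integration.integrable_sum int)
  have "fourier (\<lambda>x. u \<bullet> grad_x \<xi> x) \<kappa> =
      (\<Sum>i\<in>UNIV. u $ i * (2 * pi * \<i> * complex_of_real (\<kappa> $ i) * fourier \<xi> \<kappa>))"
    unfolding grad fourier_sum[OF int] fourier_cmult
    using assms by (simp add: fourier_regular_def)
  also have "\<dots> = 2 * pi * \<i> * (\<kappa> \<bullet> u) * fourier \<xi> \<kappa>"
    by (simp add: inner_vec_def sum_distrib_left sum_distrib_right mult_ac)
  finally show "fourier (\<lambda>x. u \<bullet> grad_x \<xi> x) \<kappa> = 2 * pi * \<i> * (\<kappa> \<bullet> u) * fourier \<xi> \<kappa>" .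
qed

text \<open>The left side is the Wronskian of \<open>cosh (m * (z - c))\<close> and
  \<open>A\<close>, two solutions of \<open>y'' = m\<^sup>2 y\<close>, hence constant; at
  \<open>c\<close> the hyperbolic factors are 1 and 0. Derivatives within \<open>S\<close> allow
  \<open>z\<close> and \<open>c\<close> to be end points.\<close>

lemma cosh_sinh_invariant:
  fixes A A' :: "real \<Rightarrow> complex"
  assumes "convex S" "z \<in> S" "c \<in> S"
    and A: "\<And>s. s \<in> S \<Longrightarrow> (A has_vector_derivative A' s) (at s within S)"
    and A': "\<And>s. s \<in> S \<Longrightarrow> (A' has_vector_derivative of_real (m\<^sup>2) * A s) (at s within S)"
  shows "complex_of_real (cosh (m * (z - c))) * A' z
    - complex_of_real (m * sinh (m * (z - c))) * A z = A' c"
proof -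
  let ?E = "\<lambda>s. cosh (m * (s - c)) *\<^sub>R A' s - (m * sinh (m * (s - c))) *\<^sub>R A s"
  have "(?E has_vector_derivative 0) (at s within S)" if "s \<in> S" for s
    by (auto intro!: derivative_eq_intros A A' that
        simp: scaleR_conv_of_real algebra_simps power2_eq_square)
  then obtain k where "\<And>s. s \<in> S \<Longrightarrow> ?E s = k"
    using has_vector_derivative_zero_constant[OF \<open>convex S\<close>, of ?E] by blast
  from this[OF \<open>z \<in> S\<close>] this[OF \<open>c \<in> S\<close>] have "?E z = ?E c"
    by (rule trans[OF _ sym])
  then show ?thesis
    by (simp add: scaleR_conv_of_real)
qed

text \<open>The horizontal transform turns the Laplace equation into the ordinary differential
  equation of \<open>cosh_sinh_invariant\<close>.\<close>

lemma fourier_harmonic_layer: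
  fixes \<Phi> :: "real ^ 'n \<Rightarrow> real \<Rightarrow> real" and \<kappa> :: "real ^ 'n"
  assumes regular: "layer_regular I \<Phi>"
    and harmonic: "\<And>x z. z \<in> I \<Longrightarrow> laplace I \<Phi> x z = 0"
    and "convex I" "z \<in> I" "c \<in> I"
  defines "m \<equiv> 2 * pi * norm \<kappa>"
  shows "complex_of_real (cosh (m * (z - c))) * fourier (\<lambda>x. partial_z I \<Phi> x z) \<kappa>
    - complex_of_real (m * sinh (m * (z - c))) * fourier (\<lambda>x. \<Phi> x z) \<kappa> = fourier (\<lambda>x. partial_z I \<Phi> x c) \<kappa>"
proof (rule cosh_sinh_invariant[OF \<open>convex I\<close> \<open>z \<in> I\<close> \<open>c \<in> I\<close>])
  fix s assume "s \<in> I"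
  with regular show "((\<lambda>s. fourier (\<lambda>x. \<Phi> x s) \<kappa>) has_vector_derivative
      fourier (\<lambda>x. partial_z I \<Phi> x s) \<kappa>) (at s within I)"
    by (simp add: layer_regular_def)
  have "(\<lambda>x. partial_z I (partial_z I \<Phi>) x s) = (\<lambda>x. - laplace_x (\<lambda>y. \<Phi> y s) x)"
    using harmonic[OF \<open>s \<in> I\<close>] by (simp add: laplace_def fun_eq_iff eq_neg_iff_add_eq_0 add.commute)
  then have "fourier (\<lambda>x. partial_z I (partial_z I \<Phi>) x s) \<kappa> =
      - fourier (laplace_x (\<lambda>y. \<Phi> y s)) \<kappa>"
    by (simp add: fourier_minus)
  \<comment> \<open>The minus sign cancels that of the Laplacian's multiplier, whose modulus is
    \<open>m\<^sup>2\<close>.\<close>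
  also have "\<dots> = of_real (m\<^sup>2) * fourier (\<lambda>x. \<Phi> x s) \<kappa>"
    using regular \<open>s \<in> I\<close>
    by (simp add: layer_regular_def fourier_regular_def m_def power_mult_distrib)
  finally have second: "fourier (\<lambda>x. partial_z I (partial_z I \<Phi>) x s) \<kappa> =
      of_real (m\<^sup>2) * fourier (\<lambda>x. \<Phi> x s) \<kappa>" .
  show "((\<lambda>s. fourier (\<lambda>x. partial_z I \<Phi> x s) \<kappa>) has_vector_derivative
      of_real (m\<^sup>2) * fourier (\<lambda>x. \<Phi> x s) \<kappa>) (at s within I)"
    unfolding second[symmetric] using regular \<open>s \<in> I\<close> by (simp add: layer_regular_def)
qed

theorem proposition1:
  fixes \<rho>\<^sub>1 \<rho>\<^sub>2 h\<^sub>1 h\<^sub>2 t :: real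
    and \<Phi>\<^sub>1 \<Phi>\<^sub>2 :: "real \<Rightarrow> real ^ 'n \<Rightarrow> real \<Rightarrow> real"
    and \<phi> :: "real \<Rightarrow> real ^ 'n \<Rightarrow> real"
    and f :: "real ^ 'n \<Rightarrow> real"
    and X U :: "real \<Rightarrow> real ^ 'n"
    and T :: "(real ^ 'n \<Rightarrow> real) \<Rightarrow> real ^ 'n \<Rightarrow> real"
    and \<kappa> :: "real ^ 'n"
  assumes dim: "CARD('n) \<in> {1, 2}"
    and densities: "0 < \<rho>\<^sub>1" "\<rho>\<^sub>1 < \<rho>\<^sub>2"
    and thicknesses: "0 < h\<^sub>1" "0 < h\<^sub>2"
    and time: "0 \<le> t"
    and regular_f: "fourier_regular f"
    and regular_1: "layer_regular {0..h\<^sub>1} (\<Phi>\<^sub>1 t)"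
    and regular_2: "layer_regular {-h\<^sub>2..0} (\<Phi>\<^sub>2 t)"
    and harmonic_1: "\<And>x z. z \<in> {0..h\<^sub>1} \<Longrightarrow> laplace {0..h\<^sub>1} (\<Phi>\<^sub>1 t) x z = 0"
    and harmonic_2: "\<And>x z. z \<in> {-h\<^sub>2..0} \<Longrightarrow> laplace {-h\<^sub>2..0} (\<Phi>\<^sub>2 t) x z = 0"
    and bottom: "\<And>x. partial_z {-h\<^sub>2..0} (\<Phi>\<^sub>2 t) x (-h\<^sub>2) = 0"
    and ship: "\<And>x. partial_z {0..h\<^sub>1} (\<Phi>\<^sub>1 t) x h\<^sub>1 = - (U t \<bullet> grad_x f (x - X t))"
    and interface:
      "\<And>x. partial_z {0..h\<^sub>1} (\<Phi>\<^sub>1 t) x 0 = partial_z {-h\<^sub>2..0} (\<Phi>\<^sub>2 t) x 0"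
    and potential: "\<And>x. \<phi> t x = \<rho>\<^sub>1 * \<Phi>\<^sub>1 t x 0 - \<rho>\<^sub>2 * \<Phi>\<^sub>2 t x 0"
    and T: "T (\<phi> t) = (\<lambda>x. partial_z {-h\<^sub>2..0} (\<Phi>\<^sub>2 t) x 0)"
    and "\<kappa> \<noteq> 0"
  shows "fourier (T (\<phi> t)) \<kappa> =
    - (2 * pi * norm \<kappa> / (layer_coeff \<rho>\<^sub>1 h\<^sub>1 \<kappa> + layer_coeff \<rho>\<^sub>2 h\<^sub>2 \<kappa>)) * fourier (\<phi> t) \<kappa>
    - 2 * pi * \<rho>\<^sub>1 * \<i> * (\<kappa> \<bullet> U t) * exp (- (2 * pi * \<i> * complex_of_real (\<kappa> \<bullet> X t))) * fourier f \<kappa>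
      / (sinh (2 * pi * norm \<kappa> * h\<^sub>1) * (layer_coeff \<rho>\<^sub>1 h\<^sub>1 \<kappa> + layer_coeff \<rho>\<^sub>2 h\<^sub>2 \<kappa>))"
proof -
  define m where "m = 2 * pi * norm \<kappa>"
  \<comment> \<open>The transform of \<open>U t \<bullet> grad_x f (x - X t)\<close>; the source
    term of the claim is \<open>\<rho>\<^sub>1 * S / (?s1 * ?D)\<close>.\<close>
  define S where "S = 2 * pi * \<i> * (\<kappa> \<bullet> U t) *
    exp (- (2 * pi * \<i> * complex_of_real (\<kappa> \<bullet> X t))) * fourier f \<kappa>"
  let ?W = "fourier (T (\<phi> t)) \<kappa>"
  let ?A = "fourier (\<lambda>x. \<Phi>\<^sub>1 t x 0) \<kappa>" and ?B = "fourier (\<lambda>x. \<Phi>\<^sub>2 t x 0) \<kappa>"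
  let ?s1 = "sinh (m * h\<^sub>1) :: real" and ?c1 = "cosh (m * h\<^sub>1) :: real"
    and ?s2 = "sinh (m * h\<^sub>2) :: real" and ?c2 = "cosh (m * h\<^sub>2) :: real"
  let ?D = "layer_coeff \<rho>\<^sub>1 h\<^sub>1 \<kappa> + layer_coeff \<rho>\<^sub>2 h\<^sub>2 \<kappa>"
  have "0 < m"
    using \<open>\<kappa> \<noteq> 0\<close> by (simp add: m_def)
  with thicknesses have pos: "0 < ?s1" "0 < ?s2"
    by simp_all
  have D: "?D = \<rho>\<^sub>1 * ?c1 / ?s1 + \<rho>\<^sub>2 * ?c2 / ?s2"
    by (simp add: layer_coeff_def coth_def m_def)
  have "0 < ?D"
    unfolding D using pos densities by (intro add_pos_pos divide_pos_pos mult_pos_pos) simp_all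
  have "fourier (\<lambda>x. partial_z {0..h\<^sub>1} (\<Phi>\<^sub>1 t) x h\<^sub>1) \<kappa> = - S"
    unfolding ship fourier_minus fourier_translate[OF fourier_inner_grad(1)[OF regular_f]]
      fourier_inner_grad(2)[OF regular_f] S_def by (simp add: mult_ac)
  \<comment> \<open>Here \<open>z = 0\<close> and \<open>c\<close> is the upper wall, so
    \<open>z - c = - h\<^sub>1\<close>, and the oddness of \<open>sinh\<close> makes the second sign
    positive. By \<open>interface\<close> the velocity at 0 is again \<open>?W\<close>.\<close>
  then have eq1: "?c1 * ?W + m * ?s1 * ?A = - S"
    using fourier_harmonic_layer[OF regular_1 harmonic_1, of 0 h\<^sub>1 \<kappa>] thicknesses
    by (simp add: T interface m_def[symmetric])
  \<comment> \<open>Now \<open>c\<close> is the bottom, where the datum is the transform of the zero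
    function.\<close>
  have eq2: "?c2 * ?W - m * ?s2 * ?B = 0"
    using fourier_harmonic_layer[OF regular_2 harmonic_2, of 0 "- h\<^sub>2" \<kappa>] thicknesses
    by (simp add: T bottom m_def[symmetric] fourier_def[of "\<lambda>x. 0"])
  have "integrable lborel (\<lambda>x. \<rho>\<^sub>1 * \<Phi>\<^sub>1 t x 0)" "integrable lborel (\<lambda>x. \<rho>\<^sub>2 * \<Phi>\<^sub>2 t x 0)"
    using regular_1 regular_2 thicknesses
    by (simp_all add: layer_regular_def fourier_regular_def integrable_with_gradient_def)
  moreover have "\<phi> t = (\<lambda>x. \<rho>\<^sub>1 * \<Phi>\<^sub>1 t x 0 - \<rho>\<^sub>2 * \<Phi>\<^sub>2 t x 0)"
    using potential by blast
  ultimately have phi: "fourier (\<phi> t) \<kappa> = \<rho>\<^sub>1 * ?A - \<rho>\<^sub>2 * ?B"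
    by (simp add: fourier_diff fourier_cmult)
  have nz: "complex_of_real ?s1 \<noteq> 0" "complex_of_real ?s2 \<noteq> 0" "complex_of_real m \<noteq> 0"
      "complex_of_real ?D \<noteq> 0"
    using pos \<open>0 < m\<close> \<open>0 < ?D\<close> by (simp_all only: of_real_eq_0_iff)
  \<comment> \<open>Solving for \<open>m * ?A\<close> and \<open>m * ?B\<close> matches the factor
    \<open>m\<close> in the final coefficient of the transform of \<open>\<phi> t\<close>.\<close>
  have A: "m * ?A = - (S + ?c1 * ?W) / ?s1"
    using eq1 nz by (simp add: field_simps)
  have B: "m * ?B = ?c2 * ?W / ?s2"
    using eq2 nz by (simp add: field_simps)
  have "m * fourier (\<phi> t) \<kappa> = \<rho>\<^sub>1 * (m * ?A) - \<rho>\<^sub>2 * (m * ?B)"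
    by (simp add: phi algebra_simps)
  \<comment> \<open>Both layers contribute to \<open>?W\<close> with the same sign, and the
    quotients \<open>?c1 / ?s1\<close> and \<open>?c2 / ?s2\<close> are the hyperbolic cotangents
    that make up \<open>?D\<close>.\<close>
  also have "\<dots> = - (\<rho>\<^sub>1 * S / ?s1) - ?D * ?W"
    unfolding A B D by (simp add: add_divide_distrib diff_divide_distrib algebra_simps)
  finally have m_phi: "m * fourier (\<phi> t) \<kappa> = - (\<rho>\<^sub>1 * S / ?s1) - ?D * ?W" .
  have "?D * ?W = - (m * fourier (\<phi> t) \<kappa>) - \<rho>\<^sub>1 * S / ?s1"
    unfolding m_phi by simp
  then have "?W = (- (m * fourier (\<phi> t) \<kappa>) - \<rho>\<^sub>1 * S / ?s1) / ?D"
    using nz(4) by (metis nonzero_mult_div_cancel_left)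
  also have "\<dots> = - (m / ?D) * fourier (\<phi> t) \<kappa> - \<rho>\<^sub>1 * S / (?s1 * ?D)"
    by (simp add: diff_divide_distrib)
  finally show ?thesis
    by (simp add: m_def S_def mult_ac)
qed

end
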